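(* Let $\mathcal H$ be a real Hilbert space, $C=\mathcal H$, and $B(x)=Mx+b$ with $M$ linear and monotone (its symmetric part positive semidefinite), $B$ $L$-Lipschitz ($L>0$), and $S=\{x:Mx+b=0\}\neq\varnothing$. Then the reflected gradient method $$x_{k+1}=x_k-\lambda B(2x_k-x_{k-1})$$ generates a sequence converging to a point of $S$ for every $$0<\lambda<\frac1{\sqrt3\,L}.$$ The constant is sharp within the affine class: for the rotation $B=J$ on $\mathbb R^2$ ($L=1$) and $\lambda>1/\sqrt3$ the iterates diverge for generic initial data.
   Context: $J$ is the counterclockwise rotation by $\pi/2$ on $\mathbb R^2$. The method is started from $x_0,x_{-1}\in\mathcal H$. "Generic initial data" means all initial data outside a proper linear subspace of the space of initial data. For $C=\mathcal H$ the variational inequality (find $z$ with $\langle B(z),x-z\rangle\ge0$ for all $x\in\mathcal H$) is equivalent to $B(z)=0$. *)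

theory Defs
  imports "HOL-Analysis.Analysis"
begin

definition monotone_operator :: "('a::real_inner \<Rightarrow> 'a) \<Rightarrow> bool"
  where "monotone_operator A \<longleftrightarrow> (\<forall>x y. 0 \<le> (A x - A y) \<bullet> (x - y))"

definition monotone_affine_problem :: "('a::real_inner \<Rightarrow> 'a) \<Rightarrow> 'a \<Rightarrow> real \<Rightarrow> bool"
  where "monotone_affine_problem M b L \<longleftrightarrow>
    linear M \<and> monotone_operator M \<and>
    0 < L \<and> L-lipschitz_on UNIV (\<lambda>x. M x + b) \<and>
    {x. M x + b = 0} \<noteq> {}"

(* The index is shifted by one: reflected_gradient B lam x0 xm1 k is the iterate x_(k-1),
   so that index 0 is x_(-1) and index 1 is x_0. *)
fun reflected_gradient ::
    "('a::real_vector \<Rightarrow> 'a) \<Rightarrow> real \<Rightarrow> 'a \<Rightarrow> 'a \<Rightarrow> nat \<Rightarrow> 'a"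
  where
    "reflected_gradient B lam x0 xm1 0 = xm1"
  | "reflected_gradient B lam x0 xm1 (Suc 0) = x0"
  | "reflected_gradient B lam x0 xm1 (Suc (Suc k)) =
       reflected_gradient B lam x0 xm1 (Suc k)
       - lam *\<^sub>R B (2 *\<^sub>R reflected_gradient B lam x0 xm1 (Suc k)
                    - reflected_gradient B lam x0 xm1 k)"

definition rotation_J :: "real^2 \<Rightarrow> real^2"
  where "rotation_J x = vector [- (x $ 2), x $ 1]"

end

theory Submission
  imports Defs
begin

text \<open>
  After translation by a solution, put \<open>T = \<lambda>M\<close> and \<open>q = \<lambda>L\<close>, so that \<open>3q\<^sup>2 < 1\<close>. With
  \<open>d\<^sub>k = x\<^sub>k - x\<^sub>k\<^sub>-\<^sub>1\<close>, the form \<open>(1 - 2q\<^sup>2)|x\<^sub>k|\<^sup>2 + 2q\<^sup>2|d\<^sub>k - d\<^sub>k\<^sub>-\<^sub>1|\<^sup>2 - q\<^sup>2|d\<^sub>k\<^sub>-\<^sub>1|\<^sup>2\<close> decreases by at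
  least \<open>(1 - 3q\<^sup>2)|d\<^sub>k|\<^sup>2\<close> per step and, despite the negative term, dominates \<open>(1 - 3q\<^sup>2)|x\<^sub>k|\<^sup>2\<close> along
  the iteration. Hence the iteration is power bounded and \<open>d\<^sub>k \<rightarrow> 0\<close>, so \<open>T x\<^sub>k \<rightarrow> 0\<close>. Iterates started
  in the range of \<open>T\<close> therefore tend to 0, and power boundedness extends this to the closure of the
  range. For monotone \<open>T\<close> the space is the sum of \<open>ker T\<close> and this closure, and iterates started
  in \<open>ker T\<close> are constant after one step.

  For the rotation, identify \<open>\<real>\<^sup>2\<close> with \<open>\<complex>\<close>: the characteristic polynomial
  \<open>z\<^sup>2 - (1 - 2\<i>\<lambda>)z - \<i>\<lambda>\<close> has for \<open>\<lambda> > 1/\<surd>3\<close> exactly one root outside the unit disc.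
\<close>

section \<open>Lyapunov analysis of the linear iteration\<close>

locale small_monotone_map =
  fixes T :: "'a::real_inner \<Rightarrow> 'a" and q :: real
  assumes linear: "linear T"
    and monotone: "0 \<le> T x \<bullet> x"
    and bound: "norm (T x) \<le> q * norm x"
    and q_small: "3 * q\<^sup>2 < 1"
begin

abbreviation iterate :: "'a \<Rightarrow> 'a \<Rightarrow> nat \<Rightarrow> 'a"
  where "iterate \<equiv> reflected_gradient T 1"

text \<open>The arguments are three consecutive iterates, oldest first, so
  \<open>z - 2 *\<^sub>R y + x\<close> is the second difference.\<close>

definition lyapunov :: "'a \<Rightarrow> 'a \<Rightarrow> 'a \<Rightarrow> real"
  where "lyapunov x y z =
    (1 - 2 * q\<^sup>2) * (z \<bullet> z)
    + 2 * q\<^sup>2 * ((z - 2 *\<^sub>R y + x) \<bullet> (z - 2 *\<^sub>R y + x))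
    - q\<^sup>2 * ((y - x) \<bullet> (y - x))"

lemma bound_inner: "T x \<bullet> T x \<le> q\<^sup>2 * (x \<bullet> x)"
proof -
  have "(norm (T x))\<^sup>2 \<le> (q * norm x)\<^sup>2"
    using bound by (rule power_mono) simp
  then show ?thesis
    by (simp add: power_mult_distrib power2_norm_eq_inner)
qed

text \<open>Monotonicity at the reflected point \<open>2z - y\<close> gives \<open>|w|\<^sup>2 \<le> |z|\<^sup>2 + |w - 2z + y|\<^sup>2 - |z - y|\<^sup>2\<close>. By
  linearity, \<open>w - 2z + y = - T (2 (z - y) - (y - x))\<close>, so the bound on \<open>T\<close> controls the second difference.\<close>

lemma lyapunov_descent:
  assumes z: "z = y - T (2 *\<^sub>R y - x)" and w: "w = z - T (2 *\<^sub>R z - y)"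
  shows "lyapunov y z w \<le> lyapunov x y z - (1 - 3 * q\<^sup>2) * ((z - y) \<bullet> (z - y))"
proof -
  define U V where "U = z \<bullet> z" and "V = w \<bullet> w"
  define D D' where "D = (z - y) \<bullet> (z - y)" and "D' = (y - x) \<bullet> (y - x)"
  define e e' where "e = (z - 2 *\<^sub>R y + x) \<bullet> (z - 2 *\<^sub>R y + x)"
    and "e' = (w - 2 *\<^sub>R z + y) \<bullet> (w - 2 *\<^sub>R z + y)"
  have Tw: "T (2 *\<^sub>R z - y) = z - w" using w by simp
  from monotone[of "2 *\<^sub>R z - y"] have "0 \<le> (z - w) \<bullet> (2 *\<^sub>R z - y)" by (simp only: Tw)
  then have V: "V \<le> U + e' - D"
    unfolding V_def U_def e'_def D_def by (simp add: inner_simps inner_commute algebra_simps)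
  have Tz: "T (2 *\<^sub>R y - x) = y - z" using z by simp
  have "2 *\<^sub>R z - 3 *\<^sub>R y + x = (2 *\<^sub>R z - y) - (2 *\<^sub>R y - x)"
    by (simp add: algebra_simps flip: scaleR_left.add) (simp add: scaleR_left_distrib[of 2 1, simplified])
  then have "T (2 *\<^sub>R z - 3 *\<^sub>R y + x) = (z - w) - (y - z)"
    by (simp only: linear_diff[OF linear, of "2 *\<^sub>R z - y" "2 *\<^sub>R y - x"] Tw Tz)
  then have "T (2 *\<^sub>R z - 3 *\<^sub>R y + x) = - (w - 2 *\<^sub>R z + y)"
    by (simp add: scaleR_2 algebra_simps)
  then have "e' \<le> q\<^sup>2 * ((2 *\<^sub>R z - 3 *\<^sub>R y + x) \<bullet> (2 *\<^sub>R z - 3 *\<^sub>R y + x))"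
    using bound_inner[of "2 *\<^sub>R z - 3 *\<^sub>R y + x"] by (simp only: e'_def inner_minus_left inner_minus_right minus_minus)
  also have "(2 *\<^sub>R z - 3 *\<^sub>R y + x) \<bullet> (2 *\<^sub>R z - 3 *\<^sub>R y + x) = 2 * D + 2 * e - D'"
    unfolding D_def D'_def e_def by (simp add: inner_simps inner_commute algebra_simps)
  finally have e': "e' \<le> q\<^sup>2 * (2 * D + 2 * e - D')" .
  \<comment> \<open>The weights 1 - 2 q^2 and 2 q^2 of the form sum to 1, so \<open>e'\<close>
    enters with coefficient 1. Its bound then reproduces 2 q^2 \<open>e\<close> - q^2
    \<open>D'\<close> and brings the coefficient of \<open>D\<close> to -(1 - 3 q^2).\<close>
  have "(1 - 2 * q\<^sup>2) * V \<le> (1 - 2 * q\<^sup>2) * (U + e' - D)"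
    using V q_small by (intro mult_left_mono) auto
  then show ?thesis
    using e' unfolding lyapunov_def U_def[symmetric] V_def[symmetric] D_def[symmetric]
      D'_def[symmetric] e_def[symmetric] e'_def[symmetric]
    by (simp add: algebra_simps)
qed

text \<open>With d the last difference and c the second difference, the form exceeds (1 - 3 q^2)
  |z|^2 by q^2 times |z|^2 + |c|^2 - |d|^2 + 2 d.c. This excess is nonnegative because q^2 < 1/3
  gives 3 |d|^2 <= |z - c|^2 and monotonicity gives d.z <= d.c.\<close>

lemma lyapunov_lower_bound:
  assumes z: "z = y - T (2 *\<^sub>R y - x)"
  shows "(1 - 3 * q\<^sup>2) * (z \<bullet> z) \<le> lyapunov x y z"
proof -
  define d c where "d = z - y" and "c = z - 2 *\<^sub>R y + x"
  have t: "z - c = 2 *\<^sub>R y - x" unfolding c_def by simp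
  have T: "T (z - c) = - d" using z unfolding t d_def by simp
  have mono: "d \<bullet> z \<le> d \<bullet> c"
    using monotone[of "z - c"] unfolding T by (simp add: inner_simps)
  have "d \<bullet> d \<le> q\<^sup>2 * ((z - c) \<bullet> (z - c))"
    using bound_inner[of "z - c"] unfolding T by simp
  also have "\<dots> \<le> 1/3 * ((z - c) \<bullet> (z - c))"
    using q_small by (intro mult_right_mono) auto
  finally have d: "3 * (d \<bullet> d) \<le> (z - c) \<bullet> (z - c)" by simp
  \<comment> \<open>Adding this square, the estimate \<open>d\<close> and twice \<open>mono\<close>
    gives twice the inequality needed next.\<close>
  have s: "0 \<le> (z + c + d) \<bullet> (z + c + d)" by simp
  have "0 \<le> z \<bullet> z + c \<bullet> c - d \<bullet> d + 2 * (d \<bullet> c)"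
    using mono d s by (simp add: inner_simps inner_commute)
  then have "0 \<le> q\<^sup>2 * (z \<bullet> z + c \<bullet> c - d \<bullet> d + 2 * (d \<bullet> c))"
    by simp
  moreover have yx: "y - x = d - c" unfolding d_def c_def by (simp add: scaleR_2)
  have "lyapunov x y z = (1 - 3 * q\<^sup>2) * (z \<bullet> z)
      + q\<^sup>2 * (z \<bullet> z + c \<bullet> c - d \<bullet> d + 2 * (d \<bullet> c))"
    unfolding lyapunov_def c_def[symmetric] yx
    by (simp add: inner_simps inner_commute algebra_simps)
  ultimately show ?thesis by simp
qed

lemma lyapunov_iterate:
  "lyapunov (iterate x0 xm1 k) (iterate x0 xm1 (Suc k)) (iterate x0 xm1 (Suc (Suc k)))
   + (\<Sum>j<k. (1 - 3 * q\<^sup>2) *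
        (norm (iterate x0 xm1 (Suc (Suc j)) - iterate x0 xm1 (Suc j)))\<^sup>2)
   \<le> lyapunov xm1 x0 (x0 - T (2 *\<^sub>R x0 - xm1))"
proof (induction k)
  case (Suc k)
  have "lyapunov (iterate x0 xm1 (Suc k)) (iterate x0 xm1 (Suc (Suc k)))
      (iterate x0 xm1 (Suc (Suc (Suc k))))
    \<le> lyapunov (iterate x0 xm1 k) (iterate x0 xm1 (Suc k)) (iterate x0 xm1 (Suc (Suc k)))
      - (1 - 3 * q\<^sup>2) * (norm (iterate x0 xm1 (Suc (Suc k)) - iterate x0 xm1 (Suc k)))\<^sup>2"
    unfolding power2_norm_eq_inner by (rule lyapunov_descent) simp_all
  with Suc.IH show ?case by (simp del: reflected_gradient.simps)
qed simp

text \<open>The lower bound makes the form nonnegative along the iteration, so the telescoped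
  descent bounds the partial sums of the squared differences.\<close>

lemma differences_tendsto_0:
  "(\<lambda>k. iterate x0 xm1 (Suc k) - iterate x0 xm1 k) \<longlonglongrightarrow> 0"
proof -
  let ?d = "\<lambda>j. (1 - 3 * q\<^sup>2) *
    (norm (iterate x0 xm1 (Suc (Suc j)) - iterate x0 xm1 (Suc j)))\<^sup>2"
  have "summable ?d"
  proof (rule summableI_nonneg_bounded)
    show "0 \<le> ?d j" for j using q_small by simp
    show "sum ?d {..<k} \<le> lyapunov xm1 x0 (x0 - T (2 *\<^sub>R x0 - xm1))" for k
    proof -
      have "0 \<le> (1 - 3 * q\<^sup>2) * (iterate x0 xm1 (Suc (Suc k)) \<bullet> iterate x0 xm1 (Suc (Suc k)))"
        using q_small by simp
      also have "\<dots> \<le> lyapunov (iterate x0 xm1 k) (iterate x0 xm1 (Suc k))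
          (iterate x0 xm1 (Suc (Suc k)))"
        by (rule lyapunov_lower_bound) simp
      finally show ?thesis using lyapunov_iterate[of x0 xm1 k] by linarith
    qed
  qed
  then have "?d \<longlonglongrightarrow> 0" by (rule summable_LIMSEQ_zero)
  then have "(\<lambda>j. (1 / (1 - 3 * q\<^sup>2)) * ?d j) \<longlonglongrightarrow> (1 / (1 - 3 * q\<^sup>2)) * 0"
    by (rule tendsto_mult_left)
  then have "(\<lambda>j. (norm (iterate x0 xm1 (Suc (Suc j)) - iterate x0 xm1 (Suc j)))\<^sup>2) \<longlonglongrightarrow> 0"
    using q_small by (simp del: reflected_gradient.simps)
  from tendsto_real_sqrt[OF this]
  have "(\<lambda>j. iterate x0 xm1 (Suc (Suc j)) - iterate x0 xm1 (Suc j)) \<longlonglongrightarrow> 0"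
    by (simp add: tendsto_norm_zero_iff del: reflected_gradient.simps)
  \<comment> \<open>The summed differences start at x_1 - x_0, one index later than the
    claim.\<close>
  then show ?thesis by (subst filterlim_sequentially_Suc[symmetric])
qed

text \<open>With d_k = x_k - x_(k-1), the recursion rearranges to T x_k = - d_(k+1) - T d_k, and
  both terms tend to 0.\<close>

lemma image_iterate_tendsto_0: "(\<lambda>k. T (iterate x0 xm1 k)) \<longlonglongrightarrow> 0"
proof -
  let ?x = "iterate x0 xm1"
  have bl: "bounded_linear T"
    by (rule bounded_linear_intro[where K = q])
       (use bound linear in \<open>auto simp: linear_add linear_cmul mult.commute\<close>)
  have "(\<lambda>k. T (?x (Suc k) - ?x k)) \<longlonglongrightarrow> T 0"
    by (rule bounded_linear.tendsto[OF bl differences_tendsto_0])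
  moreover have "(\<lambda>k. ?x (Suc (Suc k)) - ?x (Suc k)) \<longlonglongrightarrow> 0"
    using differences_tendsto_0[of x0 xm1] by (rule LIMSEQ_Suc)
  ultimately have "(\<lambda>k. - (?x (Suc (Suc k)) - ?x (Suc k)) - T (?x (Suc k) - ?x k)) \<longlonglongrightarrow> - 0 - T 0"
    by (intro tendsto_intros)
  moreover have "- (?x (Suc (Suc k)) - ?x (Suc k)) - T (?x (Suc k) - ?x k) = T (?x (Suc k))" for k
    by (simp add: linear_diff[OF linear] linear_cmul[OF linear] linear_add[OF linear] scaleR_2)
  ultimately have "(\<lambda>k. T (?x (Suc k))) \<longlonglongrightarrow> 0"
    using linear_0[OF linear] by (simp del: reflected_gradient.simps)
  then show ?thesis by (subst filterlim_sequentially_Suc[symmetric])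
qed

section \<open>Dependence on the initial data and power boundedness\<close>

lemma iterate_add:
  "iterate (x0 + y0) (xm1 + ym1) k = iterate x0 xm1 k + iterate y0 ym1 k"
  by (induction k rule: induct_nat_012)
     (simp_all add: linear_diff[OF linear] linear_add[OF linear] linear_cmul[OF linear] algebra_simps)

text \<open>Since \<open>T\<close> commutes with the recursion,
  \<open>image_iterate_tendsto_0\<close> becomes convergence to 0 of every orbit started in the
  range of \<open>T\<close>.\<close>

lemma iterate_image: "iterate (T x0) (T xm1) k = T (iterate x0 xm1 k)"
  by (induction k rule: induct_nat_012)
     (simp_all add: linear_diff[OF linear] linear_add[OF linear] linear_cmul[OF linear])

lemma iterate_kernel:
  assumes "T x0 = 0" "T xm1 = 0"
  shows "iterate x0 xm1 (Suc k) = x0"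
proof -
  \<comment> \<open>The second conjunct strengthens the induction, because the reflected point also
    involves the previous iterate.\<close>
  have "iterate x0 xm1 (Suc k) = x0 \<and> T (iterate x0 xm1 k) = 0"
    by (induction k)
       (simp_all add: assms linear_diff[OF linear] linear_cmul[OF linear])
  then show ?thesis ..
qed

text \<open>Descent bounds the form by its initial value, which is quadratic in the initial data,
  and the lower bound turns this into a bound on the iterate. Uniformity of \<open>K\<close> in the
  initial data is what the later density argument needs.\<close>

lemma iterate_power_bounded:
  obtains K where "0 < K"
    "\<And>x0 xm1 k. norm (iterate x0 xm1 k) \<le> K * (norm x0 + norm xm1)"
proof -
  define c where "c = 1 - 3 * q\<^sup>2"
  have c: "0 < c" using q_small by (simp add: c_def)
  have q1: "\<bar>q\<bar> \<le> 1" using q_small by (simp add: abs_square_le_1[symmetric])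
  have pq: "0 \<le> 1 - 2 * q\<^sup>2" "1 - 2 * q\<^sup>2 \<le> 1" "2 * q\<^sup>2 \<le> 1" using q_small by auto
  \<comment> \<open>The summand 1 covers the two initial points. The 18 is 9 + 9: x_1 and the first
    second difference have norm at most 3 \<open>N\<close>, their weights are at most 1, and the
    negative term is dropped.\<close>
  define K where "K = 1 + sqrt (18 / c)"
  show ?thesis
  proof
    show "0 < K" using c by (simp add: K_def add_pos_nonneg)
    fix x0 xm1 :: 'a and k
    define N where "N = norm x0 + norm xm1"
    have N: "0 \<le> N" "norm x0 \<le> N" "norm xm1 \<le> N" by (simp_all add: N_def)
    define z where "z = x0 - T (2 *\<^sub>R x0 - xm1)"
    have "norm (2 *\<^sub>R x0 - xm1) \<le> 2 * N"
      using norm_triangle_ineq4[of "2 *\<^sub>R x0" xm1] norm_ge_zero[of xm1]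
      unfolding N_def norm_scaleR distrib_left by linarith
    moreover have "norm (T (2 *\<^sub>R x0 - xm1)) \<le> 1 * norm (2 *\<^sub>R x0 - xm1)"
      using bound q1 by (meson abs_le_D1 mult_right_mono norm_ge_zero order_trans)
    ultimately have Tz: "norm (T (2 *\<^sub>R x0 - xm1)) \<le> 2 * N" by linarith
    then have z: "norm z \<le> 3 * N"
      using norm_triangle_ineq4[of x0 "T (2 *\<^sub>R x0 - xm1)"] N by (simp add: z_def)
    have eq: "z - 2 *\<^sub>R x0 + xm1 = (xm1 - x0) - T (2 *\<^sub>R x0 - xm1)"
      by (simp add: z_def scaleR_2)
    have e: "norm (z - 2 *\<^sub>R x0 + xm1) \<le> 3 * N"
      using norm_triangle_ineq4[of "xm1 - x0" "T (2 *\<^sub>R x0 - xm1)"]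
        norm_triangle_ineq4[of xm1 x0] Tz unfolding eq N_def distrib_left by linarith
    have "(1 - 2 * q\<^sup>2) * (norm z)\<^sup>2 \<le> 1 * (3 * N)\<^sup>2"
      using z N pq by (intro mult_mono power_mono) auto
    moreover have "2 * q\<^sup>2 * (norm (z - 2 *\<^sub>R x0 + xm1))\<^sup>2 \<le> 1 * (3 * N)\<^sup>2"
      using e N pq by (intro mult_mono power_mono) auto
    moreover have "0 \<le> q\<^sup>2 * (norm (x0 - xm1))\<^sup>2" by simp
    moreover have "(3 * N)\<^sup>2 = 9 * N\<^sup>2" by simp
    ultimately have L: "lyapunov xm1 x0 z \<le> 18 * N\<^sup>2"
      unfolding lyapunov_def power2_norm_eq_inner[symmetric] by linarith
    have "norm (iterate x0 xm1 (Suc (Suc j))) \<le> sqrt (18 / c) * N" for j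
    proof -
      have "c * (norm (iterate x0 xm1 (Suc (Suc j))))\<^sup>2
          \<le> lyapunov (iterate x0 xm1 j) (iterate x0 xm1 (Suc j)) (iterate x0 xm1 (Suc (Suc j)))"
        unfolding c_def power2_norm_eq_inner by (rule lyapunov_lower_bound) simp
      also have "\<dots> \<le> lyapunov xm1 x0 z"
      proof -
        have "0 \<le> (\<Sum>i<j. (1 - 3 * q\<^sup>2) *
            (norm (iterate x0 xm1 (Suc (Suc i)) - iterate x0 xm1 (Suc i)))\<^sup>2)"
          using q_small by (intro sum_nonneg) simp
        then show ?thesis using lyapunov_iterate[of x0 xm1 j] unfolding z_def by linarith
      qed
      finally have "(norm (iterate x0 xm1 (Suc (Suc j))))\<^sup>2 \<le> 18 / c * N\<^sup>2"
        using L c by (simp add: field_simps del: reflected_gradient.simps)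
      from real_sqrt_le_mono[OF this] show ?thesis
        using N by (simp only: real_sqrt_mult real_sqrt_abs abs_norm_cancel abs_of_nonneg)
    qed
    moreover have "0 \<le> sqrt (18 / c) * N" using c N by simp
    ultimately have "norm (iterate x0 xm1 k) \<le> N + sqrt (18 / c) * N"
    proof (induction k rule: induct_nat_012)
      case (ge2 j)
      then show ?case using N(1) by (simp only: add_increasing)
    qed (use N in auto)
    then show "norm (iterate x0 xm1 k) \<le> K * (norm x0 + norm xm1)"
      by (simp add: K_def N_def algebra_simps)
  qed
qed

text \<open>By linearity the orbit is a sum of one started in the range of \<open>T\<close>, which
  tends to 0, and one with small initial data, which stays small for all k by power
  boundedness.\<close>

lemma iterate_closure_range_tendsto_0:
  assumes "x0 \<in> closure (range T)" "xm1 \<in> closure (range T)"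
  shows "iterate x0 xm1 \<longlonglongrightarrow> 0"
proof (rule LIMSEQ_I)
  fix e :: real
  assume e: "0 < e"
  obtain K where K: "0 < K" and bnd: "\<And>x0 xm1 k. norm (iterate x0 xm1 k) \<le> K * (norm x0 + norm xm1)"
    by (rule iterate_power_bounded) blast
  \<comment> \<open>Two initial errors of this size, amplified by \<open>K\<close>, contribute at
    most e/2.\<close>
  have pos: "0 < e / (4 * K)" using e K by simp
  obtain y0 where y0: "norm (x0 - T y0) < e / (4 * K)"
    using assms(1) pos unfolding closure_approachable by (auto simp: dist_norm norm_minus_commute)
  obtain ym1 where ym1: "norm (xm1 - T ym1) < e / (4 * K)"
    using assms(2) pos unfolding closure_approachable by (auto simp: dist_norm norm_minus_commute)
  have split: "iterate x0 xm1 k = T (iterate y0 ym1 k) + iterate (x0 - T y0) (xm1 - T ym1) k" for k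
    using iterate_add[of "T y0" "x0 - T y0" "T ym1" "xm1 - T ym1" k] by (simp add: iterate_image)
  have "norm (iterate (x0 - T y0) (xm1 - T ym1) k) \<le> e / 2" for k
  proof -
    have "K * (norm (x0 - T y0) + norm (xm1 - T ym1)) \<le> K * (e / (4 * K) + e / (4 * K))"
      using y0 ym1 K by (intro mult_left_mono) auto
    also have "\<dots> = e / 2" using K by (simp add: field_simps)
    finally show ?thesis using bnd[of "x0 - T y0" "xm1 - T ym1" k] by linarith
  qed
  moreover obtain n where "\<And>k. n \<le> k \<Longrightarrow> norm (T (iterate y0 ym1 k)) < e / 2"
    using LIMSEQ_D[OF image_iterate_tendsto_0[of y0 ym1], of "e / 2"] e by auto
  ultimately show "\<exists>n. \<forall>k\<ge>n. norm (iterate x0 xm1 k - 0) < e"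
    unfolding split by (smt (verit) field_sum_of_halves norm_triangle_ineq diff_zero)
qed

end

section \<open>Kernel and closed range of a monotone linear map\<close>

text \<open>A minimizing sequence for the squared norm is Cauchy: its midpoints stay in the convex
  set, so the parallelogram law bounds the distances between its members. Completeness supplies the
  limit.\<close>

lemma closed_convex_min_norm_exists:
  fixes S :: "'a::{real_inner, complete_space} set"
  assumes "S \<noteq> {}" "closed S" "convex S"
  shows "\<exists>w\<in>S. \<forall>y\<in>S. norm w \<le> norm y"
proof -
  define m where "m = Inf ((\<lambda>x. (norm x)\<^sup>2) ` S)"
  have bdd: "bdd_below ((\<lambda>x. (norm x)\<^sup>2) ` S)"
    by (rule bdd_belowI[of _ 0]) auto
  have m_le: "m \<le> (norm y)\<^sup>2" if "y \<in> S" for y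
    unfolding m_def using bdd that by (rule cINF_lower)
  have "\<exists>x\<in>S. (norm x)\<^sup>2 < m + inverse (real (Suc n))" for n
  proof -
    have "m < m + inverse (real (Suc n))" by simp
    then show ?thesis
      unfolding m_def using cINF_less_iff[OF assms(1) bdd] by blast
  qed
  then obtain s where s: "\<And>n. s n \<in> S" "\<And>n. (norm (s n))\<^sup>2 < m + inverse (real (Suc n))"
    by metis
  have diff: "(norm (s i - s j))\<^sup>2 \<le> 2 * inverse (real (Suc i)) + 2 * inverse (real (Suc j))" for i j
  proof -
    have "(1/2) *\<^sub>R s i + (1/2) *\<^sub>R s j \<in> S"
      using assms(3) s(1) by (intro convexD) auto
    from m_le[OF this] have "4 * m \<le> (norm (s i + s j))\<^sup>2"
      by (simp add: power_mult_distrib power_divide flip: scaleR_right_distrib)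
    moreover have "(norm (s i - s j))\<^sup>2 = 2 * (norm (s i))\<^sup>2 + 2 * (norm (s j))\<^sup>2 - (norm (s i + s j))\<^sup>2"
      by (simp add: power2_norm_eq_inner inner_simps inner_commute)
    ultimately show ?thesis using s(2)[of i] s(2)[of j] by linarith
  qed
  have "Cauchy s"
  proof (rule metric_CauchyI)
    fix e :: real
    assume e: "0 < e"
    then obtain N where N: "inverse (real (Suc N)) < e\<^sup>2 / 4"
      using reals_Archimedean[of "e\<^sup>2 / 4"] by auto
    have "dist (s i) (s j) < e" if "i \<ge> N" "j \<ge> N" for i j
    proof -
      have "inverse (real (Suc i)) \<le> inverse (real (Suc N))" "inverse (real (Suc j)) \<le> inverse (real (Suc N))"
        using that by (auto intro!: le_imp_inverse_le)
      then have "(norm (s i - s j))\<^sup>2 < e\<^sup>2"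
        using diff[of i j] N by linarith
      then show ?thesis
        using e by (simp add: dist_norm power2_less_imp_less)
    qed
    then show "\<exists>N. \<forall>i\<ge>N. \<forall>j\<ge>N. dist (s i) (s j) < e" by blast
  qed
  then obtain w where w: "s \<longlonglongrightarrow> w"
    using Cauchy_convergent convergent_def by blast
  have "w \<in> S" using closed_sequentially[OF assms(2) _ w] s(1) by blast
  moreover have "(norm w)\<^sup>2 \<le> m + 0"
  proof (rule LIMSEQ_le)
    show "(\<lambda>n. (norm (s n))\<^sup>2) \<longlonglongrightarrow> (norm w)\<^sup>2" using w by (intro tendsto_intros)
    show "(\<lambda>n. m + inverse (real (Suc n))) \<longlonglongrightarrow> m + 0"
      by (intro tendsto_intros LIMSEQ_inverse_real_of_nat)
  qed (use s(2) less_imp_le in blast)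
  ultimately show ?thesis
    using m_le by (metis add_0_right norm_ge_zero order_trans power2_le_imp_le)
qed

lemma quadratic_nonneg_imp_linear_coeff_0:
  fixes a b :: real
  assumes "\<And>t. 0 \<le> t * a + t\<^sup>2 * b"
  shows "a = 0"
proof (rule ccontr)
  assume a: "a \<noteq> 0"
  \<comment> \<open>At t = -a/c the quadratic equals a^2 (b - c) / c^2, which is negative once c is
    positive and exceeds b.\<close>
  define c where "c = \<bar>b\<bar> + 1"
  have c: "0 < c" "b < c" by (auto simp: c_def)
  have "(- a / c) * a + (- a / c)\<^sup>2 * b = a\<^sup>2 * (b - c) / c\<^sup>2"
    using c by (simp add: field_simps power2_eq_square)
  moreover have "a\<^sup>2 * (b - c) / c\<^sup>2 < 0"
    using a c by (intro divide_neg_pos mult_pos_neg) auto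
  ultimately show False using assms[of "- a / c"] by linarith
qed

lemma subspace_closure:
  fixes S :: "'a::real_normed_vector set"
  assumes S: "subspace S"
  shows "subspace (closure S)"
proof (rule subspaceI)
  show "0 \<in> closure S" using subspace_0[OF S] closure_subset by blast
  fix x assume "x \<in> closure S"
  then obtain f where f: "\<And>n. f n \<in> S" "f \<longlonglongrightarrow> x"
    unfolding closure_sequential by blast
  show "c *\<^sub>R x \<in> closure S" for c
  proof -
    have "(\<lambda>n. c *\<^sub>R f n) \<longlonglongrightarrow> c *\<^sub>R x" using f(2) by (intro tendsto_intros)
    moreover have "\<forall>n. c *\<^sub>R f n \<in> S" using f(1) subspace_scale[OF S] by simp
    ultimately show ?thesis unfolding closure_sequential by (intro exI conjI)
  qed
  fix y assume "y \<in> closure S"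
  then obtain g where g: "\<And>n. g n \<in> S" "g \<longlonglongrightarrow> y"
    unfolding closure_sequential by blast
  have "(\<lambda>n. f n + g n) \<longlonglongrightarrow> x + y" using f(2) g(2) by (intro tendsto_intros)
  moreover have "\<forall>n. f n + g n \<in> S" using f(1) g(1) subspace_add[OF S] by simp
  ultimately show "x + y \<in> closure S" unfolding closure_sequential by (intro exI conjI)
qed

text \<open>The witness is the element of least norm in u + \<open>closure (range T)\<close>, which
  is orthogonal to the range of \<open>T\<close>. Monotonicity turns this orthogonality into
  membership in the kernel.\<close>

lemma monotone_kernel_closure_range_decomposition:
  fixes T :: "'a::{real_inner, complete_space} \<Rightarrow> 'a"
  assumes lin: "linear T" and mono: "\<And>x. 0 \<le> T x \<bullet> x"
  obtains w where "T w = 0" "u - w \<in> closure (range T)"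
proof -
  let ?R = "closure (range T)"
  have R: "subspace ?R"
    using lin by (intro subspace_closure linear_subspace_image subspace_UNIV)
  have "closed {x. u - x \<in> ?R}"
    using continuous_closed_vimage[of ?R "\<lambda>x. u - x"] by (simp add: vimage_def)
  moreover have "convex {x. u - x \<in> ?R}"
  proof (rule convexI)
    fix x y :: 'a and a b :: real
    assume *: "x \<in> {x. u - x \<in> ?R}" "y \<in> {x. u - x \<in> ?R}" and ab: "a + b = 1"
    have "u - (a *\<^sub>R x + b *\<^sub>R y) = a *\<^sub>R (u - x) + b *\<^sub>R (u - y)"
      using ab by (simp add: algebra_simps flip: scaleR_left_distrib)
    then show "a *\<^sub>R x + b *\<^sub>R y \<in> {x. u - x \<in> ?R}"
      using * R by (simp add: subspace_add subspace_scale)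
  qed
  moreover have "u \<in> {x. u - x \<in> ?R}"
    using subspace_0[OF R] by simp
  ultimately obtain w where w: "u - w \<in> ?R"
    and min: "\<And>y. u - y \<in> ?R \<Longrightarrow> norm w \<le> norm y"
    using closed_convex_min_norm_exists[of "{x. u - x \<in> ?R}"] by blast
  have orth: "T y \<bullet> w = 0" for y
  proof -
    \<comment> \<open>Moving \<open>w\<close> along the range stays in the set, so minimality holds
      for every real t and forces the first-order term to vanish.\<close>
    have "0 \<le> t * (2 * (T y \<bullet> w)) + t\<^sup>2 * (T y \<bullet> T y)" for t
    proof -
      have "u - w - t *\<^sub>R T y \<in> ?R"
        by (rule subspace_diff[OF R w subspace_scale[OF R]]) (simp add: closure_subset[THEN subsetD])
      then have "norm w \<le> norm (w + t *\<^sub>R T y)"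
        by (intro min) (simp add: diff_diff_eq)
      then have "(norm w)\<^sup>2 \<le> (norm (w + t *\<^sub>R T y))\<^sup>2"
        by (rule power_mono) simp
      then show ?thesis
        unfolding power2_norm_eq_inner
        by (simp add: inner_simps inner_commute power2_eq_square algebra_simps)
    qed
    from quadratic_nonneg_imp_linear_coeff_0[OF this] show ?thesis by simp
  qed
  have "T w \<bullet> y = 0" for y
  proof -
    \<comment> \<open>In the expansion of monotonicity at w + t y, orthogonality removes both T w .
      w and T y . w, leaving T w . y as the only first-order coefficient.\<close>
    have "0 \<le> t * (T w \<bullet> y) + t\<^sup>2 * (T y \<bullet> y)" for t
      using mono[of "w + t *\<^sub>R y"] orth
      by (simp add: linear_add[OF lin] linear_cmul[OF lin] inner_simps power2_eq_square algebra_simps)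
    from quadratic_nonneg_imp_linear_coeff_0[OF this] show ?thesis .
  qed
  from this[of "T w"] have "T w = 0" by simp
  with w that show ?thesis by blast
qed

section \<open>Convergence for monotone affine operators\<close>

text \<open>The coefficients 2 and -1 of the reflected point sum to 1, so translation by a solution
  passes through the recursion and removes \<open>b\<close>. Absorbing \<open>lam\<close> into the
  operator normalizes the step to 1.\<close>

lemma reflected_gradient_affine:
  assumes lin: "linear M" and z: "M z + b = 0"
  shows "reflected_gradient (\<lambda>x. M x + b) lam x0 xm1 k
    = z + reflected_gradient (\<lambda>x. lam *\<^sub>R M x) 1 (x0 - z) (xm1 - z) k"
proof (induction k rule: induct_nat_012)
  case (ge2 k)
  let ?y = "reflected_gradient (\<lambda>x. lam *\<^sub>R M x) 1 (x0 - z) (xm1 - z)"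
  have "M (2 *\<^sub>R (z + ?y (Suc k)) - (z + ?y k)) + b = M (2 *\<^sub>R ?y (Suc k) - ?y k)"
    using z by (simp add: linear_add[OF lin] linear_diff[OF lin] linear_cmul[OF lin] scaleR_2 algebra_simps)
  with ge2 show ?case by simp
qed simp_all

lemma reflected_gradient_affine_converges:
  fixes M :: "'a::{real_inner, complete_space} \<Rightarrow> 'a"
  assumes P: "monotone_affine_problem M b L" and lam: "0 < lam" "lam < 1 / (sqrt 3 * L)"
  shows "\<exists>z \<in> {x. M x + b = 0}. reflected_gradient (\<lambda>x. M x + b) lam x0 xm1 \<longlonglongrightarrow> z"
proof -
  from P have lin: "linear M" and mono: "\<And>x y. 0 \<le> (M x - M y) \<bullet> (x - y)" and L: "0 < L"
    and lip: "L-lipschitz_on UNIV (\<lambda>x. M x + b)"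
    unfolding monotone_affine_problem_def monotone_operator_def by auto
  from P obtain z where z: "M z + b = 0"
    unfolding monotone_affine_problem_def by auto
  define T where "T = (\<lambda>x. lam *\<^sub>R M x)"
  have mono0: "0 \<le> M x \<bullet> x" for x
    using mono[of x 0] linear_0[OF lin] by simp
  have bound: "norm (M x) \<le> L * norm x" for x
    using lipschitz_onD[OF lip, of x 0] linear_0[OF lin] by (simp add: dist_norm)
  have "sqrt 3 * (lam * L) < 1"
    using lam L by (simp add: field_simps)
  then have "(sqrt 3 * (lam * L))\<^sup>2 < 1"
    using lam L by (simp add: abs_square_less_1)
  then have small: "3 * (lam * L)\<^sup>2 < 1"
    by (simp add: power_mult_distrib)
  interpret small_monotone_map T "lam * L"
  proof (rule small_monotone_map.intro)
    show "linear T" unfolding T_def using lin by (rule linear_compose_scale_right)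
    show "0 \<le> T x \<bullet> x" for x using mono0 lam by (simp add: T_def)
    show "norm (T x) \<le> lam * L * norm x" for x using bound[of x] lam by (simp add: T_def)
    show "3 * (lam * L)\<^sup>2 < 1" by (rule small)
  qed
  obtain w0 where w0: "T w0 = 0" "(x0 - z) - w0 \<in> closure (range T)"
    using linear monotone by (rule monotone_kernel_closure_range_decomposition)
  obtain w1 where w1: "T w1 = 0" "(xm1 - z) - w1 \<in> closure (range T)"
    using linear monotone by (rule monotone_kernel_closure_range_decomposition)
  \<comment> \<open>The shift is needed because index 0 holds \<open>w1\<close>; the orbit is
    constant from index 1 on.\<close>
  have "iterate w0 w1 \<longlonglongrightarrow> w0"
    by (subst filterlim_sequentially_Suc[symmetric]) (simp only: iterate_kernel[OF w0(1) w1(1)] tendsto_const)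
  moreover have "iterate ((x0 - z) - w0) ((xm1 - z) - w1) \<longlonglongrightarrow> 0"
    by (rule iterate_closure_range_tendsto_0[OF w0(2) w1(2)])
  ultimately have "(\<lambda>k. z + (iterate w0 w1 k + iterate ((x0 - z) - w0) ((xm1 - z) - w1) k))
      \<longlonglongrightarrow> z + (w0 + 0)"
    by (intro tendsto_intros)
  \<comment> \<open>The limit is the chosen solution plus the kernel component of
    \<open>x0 - z\<close>.\<close>
  then have "reflected_gradient (\<lambda>x. M x + b) lam x0 xm1 \<longlonglongrightarrow> z + w0"
    unfolding reflected_gradient_affine[OF lin z, abs_def] T_def[symmetric] iterate_add[symmetric]
    by simp
  moreover have "M (z + w0) + b = 0"
    using w0(1) lam z by (simp add: T_def linear_add[OF lin])
  ultimately show ?thesis by blast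
qed

section \<open>Divergence for the rotation\<close>

text \<open>Here x_(k+1) - s x_k is geometric with ratio r, and x_(k+1) - r x_k is geometric with
  ratio s. Their difference is (r - s) x_k: the first part grows because \<open>init\<close> makes
  its coefficient nonzero, and the second stays bounded.\<close>

lemma two_term_recurrence_diverges:
  fixes x :: "nat \<Rightarrow> 'a::real_normed_field"
  assumes rec: "\<And>k. x (Suc (Suc k)) = (r + s) * x (Suc k) - r * s * x k"
    and r: "1 < norm r" and s: "norm s \<le> 1" and init: "x 1 \<noteq> s * x 0"
  shows "filterlim (\<lambda>k. norm (x k)) at_top sequentially"
proof -
  have "x (Suc (Suc k)) - s * x (Suc k) = r * (x (Suc k) - s * x k)"
    and "x (Suc (Suc k)) - r * x (Suc k) = s * (x (Suc k) - r * x k)" for k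
    by (simp_all add: rec algebra_simps)
  then have p: "x (Suc k) - s * x k = r ^ k * (x 1 - s * x 0)"
    and p': "x (Suc k) - r * x k = s ^ k * (x 1 - r * x 0)" for k
    by (induction k) simp_all
  define A B where "A = norm (x 1 - s * x 0)" and "B = norm (x 1 - r * x 0)"
  have A: "0 < A" using init by (simp add: A_def)
  have rs: "0 < norm (r - s)" using r s by auto
  have "filterlim (\<lambda>k. norm (norm r ^ k)) at_top sequentially"
    using r by (intro filterlim_at_infinity_imp_norm_at_top filterlim_realpow_sequentially_gt1) simp
  then have pow: "filterlim (\<lambda>k. norm r ^ k) at_top sequentially"
    by simp
  have "(- B + A * norm r ^ k) / norm (r - s) \<le> norm (x k)" for k
  proof -
    have "norm (s ^ k * (x 1 - r * x 0)) \<le> 1 * B"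
      unfolding norm_mult norm_power B_def using s by (intro mult_right_mono power_le_one) auto
    moreover have "(r - s) * x k = r ^ k * (x 1 - s * x 0) - s ^ k * (x 1 - r * x 0)"
      unfolding p[symmetric] p'[symmetric] by (simp add: algebra_simps)
    then have "norm (r ^ k * (x 1 - s * x 0)) - norm (s ^ k * (x 1 - r * x 0)) \<le> norm ((r - s) * x k)"
      by (simp only: norm_triangle_ineq2)
    moreover have "norm (r ^ k * (x 1 - s * x 0)) = A * norm r ^ k"
      by (simp only: norm_mult norm_power A_def mult.commute)
    ultimately have "- B + A * norm r ^ k \<le> norm (x k) * norm (r - s)"
      unfolding norm_mult[of "r - s"] by (simp add: mult.commute)
    then show ?thesis
      using rs by (simp only: pos_divide_le_eq)
  qed
  then have le: "(- B + A * norm r ^ k) * inverse (norm (r - s)) \<le> norm (x k)" for k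
    by (simp only: divide_inverse)
  have "filterlim (\<lambda>k. A * norm r ^ k) at_top sequentially"
    by (rule filterlim_tendsto_pos_mult_at_top[OF tendsto_const A pow])
  then have "filterlim (\<lambda>k. - B + A * norm r ^ k) at_top sequentially"
    by (rule filterlim_tendsto_add_at_top[OF tendsto_const])
  moreover have "0 < inverse (norm (r - s))" using rs by simp
  ultimately have "filterlim (\<lambda>k. (- B + A * norm r ^ k) * inverse (norm (r - s))) at_top sequentially"
    by (intro filterlim_at_top_mult_tendsto_pos[OF tendsto_const])
  then show ?thesis
    by (rule filterlim_at_top_mono) (intro always_eventually allI le)
qed

definition complex_of_vec2 :: "real^2 \<Rightarrow> complex"
  where "complex_of_vec2 v = Complex (v $ 1) (v $ 2)"

lemma norm_complex_of_vec2: "norm (complex_of_vec2 v) = norm v"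
  by (simp add: complex_of_vec2_def norm_vec_def L2_set_def sum_2 cmod_def)

lemma linear_complex_of_vec2: "linear complex_of_vec2"
  by (rule linearI) (simp_all add: complex_of_vec2_def complex_eq_iff)

lemma complex_of_vec2_scaleR: "complex_of_vec2 (a *\<^sub>R v) = of_real a * complex_of_vec2 v"
  by (simp add: complex_of_vec2_def complex_eq_iff)

lemma complex_of_vec2_rotation_J: "complex_of_vec2 (rotation_J v) = \<i> * complex_of_vec2 v"
  by (simp add: complex_of_vec2_def rotation_J_def complex_eq_iff)

lemma linear_rotation_J: "linear rotation_J"
  by (rule linearI) (simp_all add: rotation_J_def vec_eq_iff forall_2)

lemma norm_rotation_J: "norm (rotation_J v) = norm v"
  by (metis complex_of_vec2_rotation_J norm_complex_of_vec2 norm_mult norm_ii mult_1)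

lemma monotone_affine_problem_rotation_J: "monotone_affine_problem rotation_J 0 1"
proof -
  have "monotone_operator rotation_J"
    by (simp add: monotone_operator_def rotation_J_def inner_vec_def sum_2 algebra_simps)
  moreover have "1-lipschitz_on UNIV rotation_J"
    by (rule lipschitz_onI)
      (simp_all add: dist_norm norm_rotation_J flip: linear_diff[OF linear_rotation_J])
  moreover have "rotation_J 0 = 0" by (rule linear_0[OF linear_rotation_J])
  ultimately show ?thesis
    using linear_rotation_J by (auto simp: monotone_affine_problem_def)
qed

lemma reflected_gradient_rotation_J_diverges:
  assumes lam: "1 / sqrt 3 < lam"
  shows "\<exists>V :: ((real^2) \<times> (real^2)) set. subspace V \<and> V \<noteq> UNIV \<and>
    (\<forall>x0 xm1. (x0, xm1) \<notin> V \<longrightarrow>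
       filterlim (reflected_gradient rotation_J lam x0 xm1) at_infinity sequentially)"
proof -
  have pos: "0 < lam" using lam by (meson divide_pos_pos less_trans real_sqrt_gt_zero zero_less_numeral zero_less_one)
  have "1 < sqrt 3 * lam" using lam by (simp add: field_simps)
  then have "1 < (sqrt 3 * lam)\<^sup>2" by (simp add: one_less_power)
  then have lam2: "1 < 3 * lam\<^sup>2" by (simp add: power_mult_distrib)
  \<comment> \<open>The characteristic polynomial has discriminant 1 - 4 lam^2, which is negative
    here, so its square roots are i d and -i d.\<close>
  define d where "d = sqrt (4 * lam\<^sup>2 - 1)"
  have d2: "d\<^sup>2 = 4 * lam\<^sup>2 - 1" using lam2 by (simp add: d_def)
  \<comment> \<open>The threshold enters through d^2 - lam^2 = 3 lam^2 - 1; it yields |r|^2 > 3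
    lam^2 > 1.\<close>
  have d: "lam < d"
  proof (rule power2_less_imp_less)
    show "lam\<^sup>2 < d\<^sup>2" using lam2 by (simp add: d2)
    show "0 \<le> d" using lam2 by (simp add: d_def)
  qed
  define r s where "r = Complex (1/2) (- (2 * lam + d) / 2)" and "s = Complex (1/2) ((d - 2 * lam) / 2)"
  have ld: "lam * lam < lam * d" using d pos by simp
  have r2: "(norm r)\<^sup>2 = 2 * lam\<^sup>2 + lam * d"
    using d2 unfolding r_def cmod_power2 complex.sel by (simp add: power2_eq_square field_simps)
  have s2: "(norm s)\<^sup>2 = 2 * lam\<^sup>2 - lam * d"
    using d2 unfolding s_def cmod_power2 complex.sel by (simp add: power2_eq_square field_simps)
  have "1 < (norm r)\<^sup>2" using r2 ld lam2 by (simp add: power2_eq_square)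
  then have r1: "1 < norm r" by (simp add: power2_nonneg_gt_1_iff)
  \<comment> \<open>This is |s|^2 <= 1 rearranged; after squaring it again amounts to 3 lam^2 >=
    1.\<close>
  have "2 * lam\<^sup>2 - 1 \<le> lam * d"
  proof (rule power2_le_imp_le)
    have "(2 * lam\<^sup>2 - 1)\<^sup>2 \<le> lam\<^sup>2 * (4 * lam\<^sup>2 - 1)"
      using lam2 by (simp add: power2_eq_square algebra_simps)
    then show "(2 * lam\<^sup>2 - 1)\<^sup>2 \<le> (lam * d)\<^sup>2"
      by (simp add: power_mult_distrib d2)
    show "0 \<le> lam * d" using pos d by simp
  qed
  then have s1: "norm s \<le> 1" using s2 by (intro power2_le_imp_le[of "norm s" 1]) auto
  have sum: "r + s = 1 - 2 * \<i> * of_real lam"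
    by (simp add: r_def s_def complex_eq_iff field_simps)
  have prod: "r * s = - \<i> * of_real lam"
    using d2 by (simp add: r_def s_def complex_eq_iff power2_eq_square field_simps)
  let ?c = complex_of_vec2
  note lin = linear_complex_of_vec2
  \<comment> \<open>This is the coefficient of the growing mode, and its kernel is the exceptional
    subspace. Since index 1 is x_0 and index 0 is x_(-1), \<open>f (x0, xm1)\<close> being nonzero
    is exactly the initial condition of the recurrence lemma.\<close>
  define f :: "(real^2) \<times> (real^2) \<Rightarrow> complex" where "f = (\<lambda>p. ?c (fst p) - s * ?c (snd p))"
  have "linear f"
    by (rule linearI)
      (simp_all add: f_def linear_add[OF lin] complex_of_vec2_scaleR
        scaleR_conv_of_real[where 'a = complex] algebra_simps)
  then have "subspace {p. f p = 0}" by (rule linear_subspace_kernel)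
  moreover have "f (vector [1, 0], 0) \<noteq> 0"
    by (simp add: f_def complex_of_vec2_def complex_eq_iff)
  then have "{p. f p = 0} \<noteq> UNIV" by blast
  moreover have "filterlim (reflected_gradient rotation_J lam x0 xm1) at_infinity sequentially"
    if "(x0, xm1) \<notin> {p. f p = 0}" for x0 xm1
  proof -
    let ?x = "reflected_gradient rotation_J lam x0 xm1"
    have "filterlim (\<lambda>k. norm (?c (?x k))) at_top sequentially"
    proof (rule two_term_recurrence_diverges[OF _ r1 s1])
      show "?c (?x (Suc (Suc k))) = (r + s) * ?c (?x (Suc k)) - r * s * ?c (?x k)" for k
        unfolding sum prod
        by (simp add: linear_diff[OF lin] complex_of_vec2_scaleR complex_of_vec2_rotation_J
            algebra_simps del: mult_scaleR_left mult_scaleR_right)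
      show "?c (?x 1) \<noteq> s * ?c (?x 0)" using that by (simp add: f_def)
    qed
    then show ?thesis
      unfolding norm_complex_of_vec2 by (rule filterlim_norm_at_top_imp_at_infinity)
  qed
  ultimately show ?thesis by (intro exI[of _ "{p. f p = 0}"] conjI allI impI)
qed

theorem theorem10p3:
  "(\<forall>(M :: 'a::{real_inner, complete_space} \<Rightarrow> 'a) b L lam x0 xm1.
      monotone_affine_problem M b L \<longrightarrow> 0 < lam \<longrightarrow> lam < 1 / (sqrt 3 * L) \<longrightarrow>
      (\<exists>z \<in> {x. M x + b = 0}.
         reflected_gradient (\<lambda>x. M x + b) lam x0 xm1 \<longlonglongrightarrow> z))
   \<and> monotone_affine_problem rotation_J 0 1
   \<and> (\<forall>lam > 1 / sqrt 3.
        \<exists>V :: ((real^2) \<times> (real^2)) set. subspace V \<and> V \<noteq> UNIV \<and>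
          (\<forall>x0 xm1. (x0, xm1) \<notin> V \<longrightarrow>
             filterlim (reflected_gradient rotation_J lam x0 xm1) at_infinity sequentially))"
  by (intro conjI allI impI reflected_gradient_affine_converges monotone_affine_problem_rotation_J
      reflected_gradient_rotation_J_diverges)

end
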